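(* When $\Phi\equiv 2$ (the Markoff map that is constant equal to $2$), the polygon $\Pi$ of projectivized infinitesimal deformations of $\Phi$ that increase all entries degenerates to a round projective disk, which is also (after projectivization) the tangent cone, at $(2,2,2)$, of the closure of the deformation space $\mathcal{X}\subset\mathbb{R}^3$ of geometric Markoff maps.
   Context: Farey neighbors: two rationals $\frac pq,\frac{p'}{q'}\in\mathbb{P}^1\mathbb{Q}=\mathbb{Q}\cup\{\infty\}$ in reduced form (with $\infty=\frac10$) are Farey neighbors if $|pq'-qp'|=1$. Let $\mathcal{R}=\{R_{p/q}\}$ be the set of complementary regions of the trivalent tree in $\mathbb{H}^2$ dual to the Farey triangulation, indexed by $\mathbb{P}^1\mathbb{Q}$; two regions are adjacent iff their indices are Farey neighbors. A Markoff map is a map $\Phi:\mathcal{R}\to\mathbb{R}$ such that whenever $R,R',R'',R'''$ are distinct regions with every pair among them adjacent except $\{R,R'''\}$, one has $\Phi(R)+\Phi(R''')=\Phi(R')\Phi(R'')$. A Markoff map is determined by its values $A=\Phi(R_\infty)$, $B=\Phi(R_0)$, $C=\Phi(R_1)$, which may be arbitrary reals. It is called geometric if $\Phi(R_{p/q})>2$ for all $\frac pq$ and $K:=A^2+B^2+C^2-ABC-2<2$. The space $\mathcal{X}\subset\mathbb{R}^3$ is the set of triples $(A,B,C)$ coming from geometric Markoff maps; it identifies with the space of isotopy classes of hyperbolic metrics on the one-holed torus with geodesic boundary, a cusp, or a cone singularity of angle in $(0,2\pi)$ at the hole. An infinitesimal deformation of a Markoff map $\Phi$ is a map $\Phi':\mathcal{R}\to\mathbb{R}$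 satisfying the linearized relation $\Phi'(R)+\Phi'(R''')=\Phi'(R')\Phi(R'')+\Phi(R')\Phi'(R'')$ for all distinct regions $R,R',R'',R'''$ with every pair among them adjacent except $\{R,R'''\}$; it is determined by $(\Phi'(R_\infty),\Phi'(R_0),\Phi'(R_1))\in\mathbb{R}^3$, which is arbitrary. For $\Phi\equiv2$, $\Pi\subset\mathbb{P}^2\mathbb{R}$ denotes the projectivization of the cone of infinitesimal deformations $\Phi'$ for which all entries increase, i.e. $\Phi'(R_q)>0$ for all $q\in\mathbb{P}^1\mathbb{Q}$, in the homogeneous coordinates $[\Phi'(R_\infty):\Phi'(R_0):\Phi'(R_1)]$. (For geometric $\Phi$, the analogous region, the projectivized cone of lengthening deformations, is a convex region with infinitely many sides, hence the name "polygon".) A round projective disk is a disk bounded by a nondegenerate conic.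
   Formalization: As Π requires all entries strictly positive, it contains only some points of its bounding conic, so it is called a disk up to boundary points, and the projectivized tangent cone is shown to equal the closure of Π rather than Π itself (e.g. [1:0:1] is in the cone but not in Π). *)

theory Defs
  imports "HOL-Analysis.Analysis"
begin

section \<open>Farey neighbors and Markoff maps\<close>

text \<open>
  The projective line over the rationals. It also serves as the set of regions: the region
  indexed by \<open>x\<close> is identified with \<open>x\<close>.
\<close>

datatype p1q = Infty | Fin rat

text \<open>\<^const>\<open>quotient_of\<close> yields the reduced form with positive denominator.\<close>

fun reduced :: "p1q \<Rightarrow> int \<times> int" where
  "reduced Infty = (1, 0)"
| "reduced (Fin r) = quotient_of r"

definition farey_neighbors :: "p1q \<Rightarrow> p1q \<Rightarrow> bool" where
  "farey_neighbors x y \<longleftrightarrow>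
     (let (p, q) = reduced x; (p', q') = reduced y in \<bar>p * q' - q * p'\<bar> = 1)"

definition edge_config :: "p1q \<Rightarrow> p1q \<Rightarrow> p1q \<Rightarrow> p1q \<Rightarrow> bool" where
  "edge_config R R' R'' R''' \<longleftrightarrow>
     distinct [R, R', R'', R'''] \<and>
     farey_neighbors R R' \<and> farey_neighbors R R'' \<and> farey_neighbors R' R'' \<and>
     farey_neighbors R' R''' \<and> farey_neighbors R'' R''' \<and> \<not> farey_neighbors R R'''"

definition markoff_map :: "(p1q \<Rightarrow> real) \<Rightarrow> bool" where
  "markoff_map \<Phi> \<longleftrightarrow>
     (\<forall>R R' R'' R'''. edge_config R R' R'' R''' \<longrightarrow> \<Phi> R + \<Phi> R''' = \<Phi> R' * \<Phi> R'')"

lemma markoff_map_const_2: "markoff_map (\<lambda>_. 2)"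
  by (simp add: markoff_map_def)

definition coords :: "(p1q \<Rightarrow> real) \<Rightarrow> real ^ 3" where
  "coords \<Phi> = vector [\<Phi> Infty, \<Phi> (Fin 0), \<Phi> (Fin 1)]"

definition geometric :: "(p1q \<Rightarrow> real) \<Rightarrow> bool" where
  "geometric \<Phi> \<longleftrightarrow>
     markoff_map \<Phi> \<and> (\<forall>R. \<Phi> R > 2) \<and>
     (let A = \<Phi> Infty; B = \<Phi> (Fin 0); C = \<Phi> (Fin 1)
      in A\<^sup>2 + B\<^sup>2 + C\<^sup>2 - A * B * C - 2 < 2)"

definition deformation_space :: "(real ^ 3) set" where
  "deformation_space = {coords \<Phi> | \<Phi>. geometric \<Phi>}"

definition infinitesimal_deformation :: "(p1q \<Rightarrow> real) \<Rightarrow> (p1q \<Rightarrow> real) \<Rightarrow> bool" where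
  "infinitesimal_deformation \<Phi> \<Phi>' \<longleftrightarrow>
     (\<forall>R R' R'' R'''. edge_config R R' R'' R''' \<longrightarrow>
        \<Phi>' R + \<Phi>' R''' = \<Phi>' R' * \<Phi> R'' + \<Phi> R' * \<Phi>' R'')"

definition increasing_cone :: "(p1q \<Rightarrow> real) \<Rightarrow> (real ^ 3) set" where
  "increasing_cone \<Phi> =
     {coords \<Phi>' | \<Phi>'. infinitesimal_deformation \<Phi> \<Phi>' \<and> (\<forall>R. \<Phi>' R > 0)}"


section \<open>The real projective plane\<close>

text \<open>A point of the projective plane is a line through the origin.\<close>

definition proj_point :: "real ^ 3 \<Rightarrow> (real ^ 3) set" where
  "proj_point v = span {v}"

definition projectivize :: "(real ^ 3) set \<Rightarrow> (real ^ 3) set set" where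
  "projectivize C = proj_point ` (C - {0})"

text \<open>The quotient topology; see \<open>quotient_map_proj_point\<close>.\<close>

definition projective_plane :: "(real ^ 3) set topology" where
  "projective_plane =
     topology (\<lambda>U. U \<subseteq> projectivize UNIV \<and> open {v. v \<noteq> 0 \<and> proj_point v \<in> U})"

lemma openin_projective_plane:
  "openin projective_plane U \<longleftrightarrow>
     U \<subseteq> projectivize UNIV \<and> open {v. v \<noteq> 0 \<and> proj_point v \<in> U}"
proof -
  have "istopology (\<lambda>U. U \<subseteq> projectivize UNIV \<and> open {v. v \<noteq> 0 \<and> proj_point v \<in> U})"
    unfolding istopology_def
  proof (intro conjI allI impI)
    fix S T
    assume S: "S \<subseteq> projectivize UNIV \<and> open {v. v \<noteq> 0 \<and> proj_point v \<in> S}"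
      and T: "T \<subseteq> projectivize UNIV \<and> open {v. v \<noteq> 0 \<and> proj_point v \<in> T}"
    have "{v. v \<noteq> 0 \<and> proj_point v \<in> S \<inter> T} =
          {v. v \<noteq> 0 \<and> proj_point v \<in> S} \<inter> {v. v \<noteq> 0 \<and> proj_point v \<in> T}" by auto
    with S T show "open {v. v \<noteq> 0 \<and> proj_point v \<in> S \<inter> T}" by auto
    from S show "S \<inter> T \<subseteq> projectivize UNIV" by auto
  next
    fix \<K> assume K: "\<forall>K\<in>\<K>. K \<subseteq> projectivize UNIV \<and> open {v. v \<noteq> 0 \<and> proj_point v \<in> K}"
    have "{v. v \<noteq> 0 \<and> proj_point v \<in> \<Union>\<K>} = (\<Union>K\<in>\<K>. {v. v \<noteq> 0 \<and> proj_point v \<in> K})" by auto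
    with K show "open {v. v \<noteq> 0 \<and> proj_point v \<in> \<Union>\<K>}" by auto
    from K show "\<Union>\<K> \<subseteq> projectivize UNIV" by auto
  qed
  then show ?thesis
    by (simp add: projective_plane_def topology_inverse')
qed

lemma topspace_projective_plane: "topspace projective_plane = projectivize UNIV"
proof -
  have "{v :: real ^ 3. v \<noteq> 0 \<and> proj_point v \<in> projectivize UNIV} = - {0}"
    by (auto simp: projectivize_def)
  then have "openin projective_plane (projectivize UNIV)"
    by (simp add: openin_projective_plane open_Compl)
  then show ?thesis
    by (metis openin_projective_plane openin_subset openin_topspace subset_antisym)
qed

lemma quotient_map_proj_point:
  "quotient_map (top_of_set (- {0})) projective_plane proj_point"
proof -
  have img: "proj_point ` (- {0}) = projectivize UNIV"
    by (simp add: projectivize_def Compl_eq_Diff_UNIV)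
  have "openin (top_of_set (- {0})) {v \<in> - {0}. proj_point v \<in> U} \<longleftrightarrow>
        openin projective_plane U" if "U \<subseteq> projectivize UNIV" for U
  proof -
    have "{v \<in> - {0}. proj_point v \<in> U} = {v. v \<noteq> 0 \<and> proj_point v \<in> U}" by auto
    moreover have "open (- {0 :: real ^ 3})" by (simp add: open_Compl)
    ultimately show ?thesis using that
      by (auto simp: openin_projective_plane openin_open_eq)
  qed
  then show ?thesis
    by (simp add: quotient_map_def img topspace_projective_plane)
qed

definition nondegenerate_conic :: "(real ^ 3) set set \<Rightarrow> bool" where
  "nondegenerate_conic Q \<longleftrightarrow>
     (\<exists>M :: real ^ 3 ^ 3. transpose M = M \<and> det M \<noteq> 0 \<and>
        Q = projectivize {v. v \<bullet> (M *v v) = 0})"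

text \<open>
  The condition on the interior selects the side of the conic that is a disk; the other side is
  a Moebius band. It also rules out conics without real points, which bound no disk. A disk in
  this sense may contain all, some or none of the points of its bounding conic.
\<close>

definition round_projective_disk :: "(real ^ 3) set set \<Rightarrow> bool" where
  "round_projective_disk D \<longleftrightarrow>
     D \<subseteq> topspace projective_plane \<and>
     nondegenerate_conic (projective_plane frontier_of D) \<and>
     subtopology projective_plane (projective_plane interior_of D)
       homeomorphic_space top_of_set (ball (0 :: real ^ 2) 1)"

text \<open>
  For the constant map 2, a deformation is \<open>p/q \<mapsto> f(p, q)\<close> for a binary quadratic form \<open>f\<close>.
  The forms \<open>(p - t * q)\<^sup>2\<close> with \<open>t\<close> irrational are positive on all of \<^typ>\<open>p1q\<close>, those with
  \<open>t\<close> rational are not; hence the polygon of this map contains some but not all of its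
  boundary points.
\<close>

definition polygon :: "(p1q \<Rightarrow> real) \<Rightarrow> (real ^ 3) set set" where
  "polygon \<Phi> = projectivize (increasing_cone \<Phi>)"


section \<open>Tangent cones\<close>

text \<open>The (Bouligand) tangent cone: limits of rescaled secants of \<open>S\<close> at \<open>p\<close>.\<close>

definition tangent_cone :: "'a :: real_normed_vector set \<Rightarrow> 'a \<Rightarrow> 'a set" where
  "tangent_cone S p =
     {v. \<exists>x t. (\<forall>n :: nat. x n \<in> S \<and> t n > (0 :: real)) \<and> x \<longlonglongrightarrow> p \<and>
               (\<lambda>n. t n *\<^sub>R (x n - p)) \<longlonglongrightarrow> v}"

end

theory Submission
  imports Defs
begin

text \<open>
  Deformations of the constant map 2 obey the parallelogram law, so they are binary quadratic forms
  evaluated at reduced fractions. Those positive on all rationals lie between the positive definite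
  and the positive semidefinite ones, so up to sign the polygon lies between \<open>disc > 0\<close> and
  \<open>disc \<ge> 0\<close>, where \<open>disc\<close> is minus the discriminant, a nondegenerate quadratic form of signature (1, 2).

  With \<open>A = 2 + a\<close>, \<open>B = 2 + b\<close>, \<open>C = 2 + c\<close> the condition \<open>K < 2\<close> reads \<open>disc (a, b, c) + abc > 0\<close>, whose
  leading part is the same form. Vieta jumping shows that all \<open>A, B, C > 2\<close> with \<open>K < 2\<close> are
  coordinates of geometric Markoff maps.
\<close>

section \<open>Regions and unimodular pairs\<close>

text \<open>Takes any integer vector and ignores its sign, so sums and differences of primitive
  vectors can be used as indices without normalizing the denominator.\<close>

definition region :: "int \<Rightarrow> int \<Rightarrow> p1q" where
  "region p q = (if q = 0 then Infty else Fin (of_int p / of_int q))"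

lemma region_uminus: "region (- p) (- q) = region p q"
  by (simp add: region_def)

lemma coprime_reduced: "reduced R = (p, q) \<Longrightarrow> coprime p q"
  by (cases R) (auto dest: quotient_of_coprime)

lemma region_of_reduced: "reduced R = (p, q) \<Longrightarrow> region p q = R"
proof (cases R)
  case (Fin r)
  assume "reduced R = (p, q)"
  with Fin have "quotient_of r = (p, q)" by simp
  with Fin quotient_of_denom_pos[OF this] quotient_of_div[OF this] show ?thesis
    by (simp add: region_def)
qed (auto simp: region_def)

lemma region_cases:
  obtains p q where "coprime p q" "R = region p q"
  by (metis coprime_reduced region_of_reduced surj_pair)

text \<open>A primitive vector is determined by its slope up to sign. This ambiguity is harmless
  below, since determinants enter only through their absolute value and the functions used are
  even.\<close>

lemma reduced_region:
  assumes "coprime p q"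
  shows "reduced (region p q) = (p, q) \<or> reduced (region p q) = (- p, - q)"
proof (cases "q = 0")
  case True
  with assms have "p = 1 \<or> p = - 1" by auto
  with True show ?thesis by (auto simp: region_def)
next
  case False
  with assms show ?thesis
    by (auto simp: region_def quotient_of_Fract Rat.normalize_def Let_def simp flip: Fract_of_int_quotient)
qed

lemma farey_neighbors_region:
  assumes "coprime p q" "coprime r s"
  shows "farey_neighbors (region p q) (region r s) \<longleftrightarrow> \<bar>p * s - q * r\<bar> = 1"
  using reduced_region[OF assms(1)] reduced_region[OF assms(2)]
  by (auto simp: farey_neighbors_def)

lemma unimodular_coprime:
  fixes p q r s :: int
  assumes "\<bar>p * s - q * r\<bar> = 1"
  shows "coprime p q" "coprime r s"
proof -
  have "is_unit c" if "c dvd p * s - q * r" for c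
    using that assms by (metis dvd_abs_iff)
  then show "coprime p q" "coprime r s"
    by (auto intro!: coprimeI)
qed

lemma not_farey_neighbors_self: "\<not> farey_neighbors R R"
  by (auto simp: farey_neighbors_def Let_def split: prod.splits)

text \<open>All determinants among the four vectors are 1 or -1, except that of the difference and
  the sum, which is twice the determinant of the basis.\<close>

lemma edge_config_region:
  assumes "\<bar>p * s - q * r\<bar> = 1"
  shows "edge_config (region (p - r) (q - s)) (region r s) (region p q) (region (p + r) (q + s))"
proof -
  have d: "\<bar>(p - r) * s - (q - s) * r\<bar> = 1" "\<bar>(p - r) * q - (q - s) * p\<bar> = 1"
    "\<bar>r * q - s * p\<bar> = 1" "\<bar>r * (q + s) - s * (p + r)\<bar> = 1" "\<bar>p * (q + s) - q * (p + r)\<bar> = 1"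
    "\<bar>(p - r) * (q + s) - (q - s) * (p + r)\<bar> = 2"
    using assms by (auto simp: algebra_simps abs_if split: if_splits)
  note c = unimodular_coprime[OF assms] unimodular_coprime(1)[OF d(1)] unimodular_coprime(2)[OF d(4)]
  have ne: "region (p - r) (q - s) \<noteq> region (p + r) (q + s)"
  proof
    assume "region (p - r) (q - s) = region (p + r) (q + s)"
    with reduced_region[OF c(3)] reduced_region[OF c(4)]
    have "p - r = p + r \<and> q - s = q + s \<or> p - r = - (p + r) \<and> q - s = - (q + s)" by auto
    then have "r = 0 \<and> s = 0 \<or> p = 0 \<and> q = 0" by auto
    with assms show False by auto
  qed
  have "farey_neighbors (region (p - r) (q - s)) (region r s)"
    "farey_neighbors (region (p - r) (q - s)) (region p q)"
    "farey_neighbors (region r s) (region p q)"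
    "farey_neighbors (region r s) (region (p + r) (q + s))"
    "farey_neighbors (region p q) (region (p + r) (q + s))"
    "\<not> farey_neighbors (region (p - r) (q - s)) (region (p + r) (q + s))"
    using c d by (simp_all add: farey_neighbors_region)
  with ne show ?thesis
    unfolding edge_config_def distinct.simps by (auto simp: not_farey_neighbors_self)
qed

text \<open>Cramer's rule: in the basis \<open>(p, q)\<close>, \<open>(r, s)\<close> the
  coefficients of a common neighbor are determinants up to sign, hence 1 or -1. Up to a global sign
  this leaves the sum and the difference.\<close>

lemma common_neighbor:
  assumes "\<bar>p * s - q * r\<bar> = 1"
    and R: "farey_neighbors R (region r s)" "farey_neighbors R (region p q)"
  shows "R = region (p + r) (q + s) \<or> R = region (p - r) (q - s)"
proof -
  obtain a b where ab: "coprime a b" "R = region a b" by (rule region_cases)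
  note c = unimodular_coprime[OF assms(1)]
  define \<delta> \<alpha> \<beta> where "\<delta> = p * s - q * r" and "\<alpha> = a * s - b * r" and "\<beta> = a * q - b * p"
  have "a * \<delta> = p * \<alpha> - r * \<beta>" "b * \<delta> = q * \<alpha> - s * \<beta>"
    by (auto simp: \<delta>_def \<alpha>_def \<beta>_def algebra_simps)
  moreover have "\<delta> = 1 \<or> \<delta> = - 1" "\<alpha> = 1 \<or> \<alpha> = - 1" "\<beta> = 1 \<or> \<beta> = - 1"
    using assms ab c by (auto simp: farey_neighbors_region \<delta>_def \<alpha>_def \<beta>_def)
  ultimately have "(a = p + r \<and> b = q + s) \<or> (a = p - r \<and> b = q - s) \<or>
      (a = - (p + r) \<and> b = - (q + s)) \<or> (a = - (p - r) \<and> b = - (q - s))"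
    by auto
  then show ?thesis
    unfolding ab(2) by (metis region_uminus)
qed

lemma edge_configE:
  assumes "edge_config R R' R'' R'''"
  obtains p q r s where "\<bar>p * s - q * r\<bar> = 1" "R = region (p - r) (q - s)" "R' = region r s"
    "R'' = region p q" "R''' = region (p + r) (q + s)"
proof -
  obtain p q where p: "coprime p q" "R'' = region p q" by (rule region_cases)
  obtain r s where r: "coprime r s" "R' = region r s" by (rule region_cases)
  have sym: "farey_neighbors x y \<Longrightarrow> farey_neighbors y x" for x y
    by (auto simp: farey_neighbors_def Let_def abs_minus_commute mult.commute split: prod.splits)
  have "\<bar>r * q - s * p\<bar> = 1"
    using assms p r farey_neighbors_region[OF r(1) p(1)] by (simp add: edge_config_def)
  then have u: "\<bar>p * s - q * r\<bar> = 1" by (simp add: abs_minus_commute mult.commute)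
  have "R = region (p + r) (q + s) \<or> R = region (p - r) (q - s)"
    "R''' = region (p + r) (q + s) \<or> R''' = region (p - r) (q - s)" "R \<noteq> R'''"
    using assms common_neighbor[OF u] p r by (auto simp: edge_config_def intro: sym)
  then consider "R = region (p - r) (q - s)" "R''' = region (p + r) (q + s)"
    | "R = region (p + r) (q + s)" "R''' = region (p - r) (q - s)" by blast
  then show ?thesis
  proof cases
    case 1
    with u p r that show ?thesis by blast
  next
    case 2
    \<comment> \<open>Replacing \<open>(r, s)\<close> by its negative exchanges sum and
      difference.\<close>
    with u p r that[of p "- s" q "- r"] region_uminus[of r s] show ?thesis
      by (simp add: abs_minus_commute)
  qed
qed

section \<open>Deformations of the constant map\<close>

text \<open>The binary quadratic form whose values at (1,0), (0,1) and (1,1) are the coordinates of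
  \<open>v\<close>; these are the values at \<open>Infty\<close>, \<open>Fin 0\<close> and
  \<open>Fin 1\<close>.\<close>

definition form :: "real ^ 3 \<Rightarrow> real \<Rightarrow> real \<Rightarrow> real" where
  "form v x y = v $ 1 * x\<^sup>2 + (v $ 3 - v $ 1 - v $ 2) * x * y + v $ 2 * y\<^sup>2"

lemma form_uminus: "form v (- x) (- y) = form v x y"
  by (simp add: form_def)

lemma form_reduced_region:
  assumes "coprime p q" "reduced (region p q) = (p', q')"
  shows "form v (of_int p') (of_int q') = form v (of_int p) (of_int q)"
  using reduced_region[OF assms(1)] assms(2) by (auto simp: form_uminus)

text \<open>At the constant map 2 the linearized relation is
  \<open>f(x - y) + f(x + y) = 2 f(x) + 2 f(y)\<close>, the parallelogram law of a quadratic
  form.\<close>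

lemma form_deformation:
  "infinitesimal_deformation (\<lambda>_. 2) (\<lambda>R. case reduced R of (p, q) \<Rightarrow> form v (of_int p) (of_int q))"
    (is "infinitesimal_deformation _ ?F")
  unfolding infinitesimal_deformation_def
proof (intro allI impI)
  fix R R' R'' R'''
  assume "edge_config R R' R'' R'''"
  then obtain p q r s where u: "\<bar>p * s - q * r\<bar> = 1" and R: "R = region (p - r) (q - s)"
    "R' = region r s" "R'' = region p q" "R''' = region (p + r) (q + s)"
    by (rule edge_configE)
  have F: "?F (region a b) = form v (of_int a) (of_int b)" if "coprime a b" for a b
    using form_reduced_region[OF that] by (auto split: prod.splits)
  have "coprime (p - r) (q - s)" "coprime (p + r) (q + s)"
    using u by (auto intro!: unimodular_coprime(1)[of _ s _ r] simp: algebra_simps)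
  with unimodular_coprime[OF u]
  show "?F R + ?F R''' = ?F R' * 2 + 2 * ?F R''"
    unfolding R by (simp add: F) (simp add: form_def algebra_simps power2_eq_square)
qed

text \<open>Euclid's algorithm: a shear of the lattice replaces the superbasis \<open>(1,0), (0,1), (1,1)\<close> by an
  adjacent one and transforms the form accordingly.\<close>

lemma parallelogram_eq_form:
  fixes d :: "int \<Rightarrow> int \<Rightarrow> real"
  assumes rel: "\<And>p q r s. \<bar>p * s - q * r\<bar> = 1 \<Longrightarrow>
      d (p - r) (q - s) + d (p + r) (q + s) = 2 * (d p q + d r s)"
    and "coprime p q" "p \<ge> 0" "q \<ge> 0"
  shows "d p q = form (vector [d 1 0, d 0 1, d 1 1]) (of_int p) (of_int q)"
  using assms
proof (induction "nat (p + q)" arbitrary: p q d rule: less_induct)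
  case less
  consider "p = 0" | "q = 0" | "p = 1" "q = 1" | "0 < q" "q < p" | "0 < p" "p < q"
  proof -
    have "p = q \<Longrightarrow> p = 1" using less.prems(2,3) by auto
    with less.prems(3,4) that show thesis by linarith
  qed
  then show ?case
  proof cases
    case 1
    with less.prems(2,4) have "q = 1" by auto
    with 1 show ?thesis by (simp add: form_def)
  next
    case 2
    with less.prems(2,3) have "p = 1" by auto
    with 2 show ?thesis by (simp add: form_def)
  next
    case 3
    then show ?thesis by (simp add: form_def)
  next
    case 4
    \<comment> \<open>The shear makes (1,0), (1,1), (2,1) the new superbasis and shortens
      \<open>(p, q)\<close> to \<open>(p - q, q)\<close>.\<close>
    define d' where "d' = (\<lambda>x y. d (x + y) y)"
    have "d' (p - q) q = form (vector [d' 1 0, d' 0 1, d' 1 1]) (of_int (p - q)) (of_int q)"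
    proof (rule less.hyps)
      show "coprime (p - q) q" using less.prems(2) by (metis coprime_iff_gcd_eq_1 gcd_diff1)
      fix a b c e :: int assume "\<bar>a * e - b * c\<bar> = 1"
      then have "\<bar>(a + b) * e - b * (c + e)\<bar> = 1" by (simp add: algebra_simps)
      from less.prems(1)[OF this]
      show "d' (a - c) (b - e) + d' (a + c) (b + e) = 2 * (d' a b + d' c e)"
        by (simp add: d'_def algebra_simps)
    qed (use 4 in auto)
    \<comment> \<open>This is \<open>d' 1 1\<close>, the only value on the new superbasis that is
      not among the old three.\<close>
    moreover have "d 2 1 = 2 * (d 1 1 + d 1 0) - d 0 1"
      using less.prems(1)[of 1 0 1 1] by simp
    ultimately show ?thesis
      by (simp add: d'_def form_def algebra_simps power2_eq_square)
  next
    case 5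
    define d' where "d' = (\<lambda>x y. d x (x + y))"
    have "d' p (q - p) = form (vector [d' 1 0, d' 0 1, d' 1 1]) (of_int p) (of_int (q - p))"
    proof (rule less.hyps)
      show "coprime p (q - p)" using less.prems(2) by (metis coprime_iff_gcd_eq_1 gcd_diff1 gcd.commute)
      fix a b c e :: int assume "\<bar>a * e - b * c\<bar> = 1"
      then have "\<bar>a * (c + e) - (a + b) * c\<bar> = 1" by (simp add: algebra_simps)
      from less.prems(1)[OF this]
      show "d' (a - c) (b - e) + d' (a + c) (b + e) = 2 * (d' a b + d' c e)"
        by (simp add: d'_def algebra_simps)
    qed (use 5 in auto)
    moreover have "d 1 2 = 2 * (d 1 1 + d 0 1) - d 1 0"
      using less.prems(1)[of 1 1 1 0] by simp
    ultimately show ?thesis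
      by (simp add: d'_def form_def algebra_simps power2_eq_square)
  qed
qed

text \<open>\<open>parallelogram_eq_form\<close> covers nonnegative slopes. Negative slopes follow
  by reflecting the first coordinate, and negative denominators by the sign symmetry.\<close>

lemma deformation_eq_form:
  assumes "infinitesimal_deformation (\<lambda>_. 2) \<Phi>'" "coprime p q"
  shows "\<Phi>' (region p q) = form (coords \<Phi>') (of_int p) (of_int q)"
proof -
  have rel: "\<Phi>' (region (p - r) (q - s)) + \<Phi>' (region (p + r) (q + s)) =
      2 * (\<Phi>' (region p q) + \<Phi>' (region r s))" if "\<bar>p * s - q * r\<bar> = 1" for p q r s
    using assms(1) edge_config_region[OF that] unfolding infinitesimal_deformation_def by fastforce
  have *: "\<Phi>' (region p q) = form (coords \<Phi>') (of_int p) (of_int q)"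
    if "coprime p q" "q \<ge> 0" for p q
  proof (cases "p \<ge> 0")
    case True
    with parallelogram_eq_form[of "\<lambda>p q. \<Phi>' (region p q)" p q] rel that show ?thesis
      by (simp add: coords_def region_def)
  next
    case False
    define d where "d = (\<lambda>x y. \<Phi>' (region (- x) y))"
    have "d (- p) q = form (vector [d 1 0, d 0 1, d 1 1]) (of_int (- p)) (of_int q)"
    proof (rule parallelogram_eq_form)
      fix a b c e :: int assume "\<bar>a * e - b * c\<bar> = 1"
      then have "\<bar>(- a) * e - b * (- c)\<bar> = 1" by (simp add: abs_minus_commute)
      from rel[OF this] show "d (a - c) (b - e) + d (a + c) (b + e) = 2 * (d a b + d c e)"
        by (simp add: d_def)
    qed (use False that in auto)
    \<comment> \<open>The third value after reflection belongs to the slope -1, which lies opposite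
      the slope 1 across the edge between \<open>Infty\<close> and \<open>Fin 0\<close>.\<close>
    moreover have "d 1 1 = 2 * (\<Phi>' Infty + \<Phi>' (Fin 0)) - \<Phi>' (Fin 1)"
      using rel[of 1 1 0 0] region_uminus[of 1 "- 1"] by (simp add: d_def region_def)
    moreover have "d 1 0 = \<Phi>' Infty" "d 0 1 = \<Phi>' (Fin 0)" "d (- p) q = \<Phi>' (region p q)"
      by (simp_all add: d_def region_def)
    ultimately show ?thesis
      by (simp add: coords_def form_def algebra_simps)
  qed
  show ?thesis
  proof (cases "q \<ge> 0")
    case False
    with *[of "- p" "- q"] assms(2) show ?thesis by (simp add: region_uminus form_uminus)
  qed (use * assms(2) in blast)
qed


section \<open>Markoff maps with prescribed coordinates\<close>

text \<open>The Markoff value at the vector \<open>(p, q)\<close>, where \<open>A\<close>,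
  \<open>B\<close>, \<open>C\<close> are the values at (1,0), (0,1), (1,1). Each Euclidean step
  passes to an adjacent superbasis containing (1,1), whose new third value is given by the Markoff
  relation.\<close>

function euclid_markoff :: "nat \<Rightarrow> nat \<Rightarrow> real \<Rightarrow> real \<Rightarrow> real \<Rightarrow> real" where
  "euclid_markoff p q A B C =
     (if p = 0 then B else if q = 0 then A
      else if q \<le> p then euclid_markoff (p - q) q A C (A * C - B)
      else euclid_markoff p (q - p) C B (B * C - A))"
  by pat_completeness auto
termination by (relation "Wellfounded.measure (\<lambda>(p, q, _). p + q)") auto

declare euclid_markoff.simps [simp del]

lemma euclid_markoff_0: "euclid_markoff 0 q A B C = B" "p > 0 \<Longrightarrow> euclid_markoff p 0 A B C = A"
  by (simp_all add: euclid_markoff.simps)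

text \<open>On the diagonal both branches return \<open>C\<close>, so either step may be taken
  there. The two cases thus become symmetric.\<close>

lemma euclid_markoff_step:
  "q \<le> p \<Longrightarrow> p > 0 \<Longrightarrow> euclid_markoff p q A B C = euclid_markoff (p - q) q A C (A * C - B)"
  "p \<le> q \<Longrightarrow> q > 0 \<Longrightarrow> euclid_markoff p q A B C = euclid_markoff p (q - p) C B (B * C - A)"
  by (auto simp: euclid_markoff_0 euclid_markoff.simps[of p q])

lemma euclid_markoff_small:
  "euclid_markoff (Suc 0) (Suc 0) A B C = C"
  "euclid_markoff (Suc (Suc 0)) (Suc 0) A B C = A * C - B"
  "euclid_markoff (Suc 0) (Suc (Suc 0)) A B C = B * C - A"
proof -
  show 1: "euclid_markoff (Suc 0) (Suc 0) A B C = C" for A B C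
    using euclid_markoff_step(1)[of "Suc 0" "Suc 0" A B C] by (simp add: euclid_markoff_0)
  show "euclid_markoff (Suc (Suc 0)) (Suc 0) A B C = A * C - B"
    "euclid_markoff (Suc 0) (Suc (Suc 0)) A B C = B * C - A"
    using euclid_markoff_step(1)[of "Suc 0" "Suc (Suc 0)" A B C]
      euclid_markoff_step(2)[of "Suc 0" "Suc (Suc 0)" A B C] 1 by simp_all
qed

text \<open>Either pair of strict inequalities gives \<open>p * s >= (q + 1) * (r + 1)\<close>, so
  the determinant is at least \<open>q + r + 1\<close>. Being 1 in absolute value, it forces
  \<open>q = r = 0\<close>.\<close>

lemma unimodular_nonneg:
  fixes p q r s :: int
  assumes "\<bar>p * s - q * r\<bar> = 1" "p \<ge> 0" "q \<ge> 0" "r \<ge> 0" "s \<ge> 0"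
  shows unimodular_nonneg_diag: "q < p \<Longrightarrow> r < s \<Longrightarrow> p = 1 \<and> q = 0 \<and> r = 0 \<and> s = 1"
    and unimodular_nonneg_sub: "r < p \<Longrightarrow> q < s \<Longrightarrow> p = 1 \<and> q = 0 \<and> r = 0 \<and> s = 1"
proof -
  have *: "p = 1 \<and> q = 0 \<and> r = 0 \<and> s = 1" if "q * r + q + r + 1 \<le> p * s"
  proof -
    have "q * r \<ge> 0" using assms by simp
    with that assms have "q = 0" "r = 0" by linarith+
    with assms show ?thesis by (simp add: zmult_eq_1_iff)
  qed
  show "p = 1 \<and> q = 0 \<and> r = 0 \<and> s = 1" if "q < p" "r < s"
    using mult_mono[of "q + 1" p "r + 1" s] that assms by (intro *) (simp add: algebra_simps)
  show "p = 1 \<and> q = 0 \<and> r = 0 \<and> s = 1" if "r < p" "q < s"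
    using mult_mono[of "r + 1" p "q + 1" s] that assms by (intro *) (simp add: algebra_simps)
qed

text \<open>The difference vector \<open>(p, q)\<close> is the starting point, which avoids
  subtraction on naturals. If \<open>(p, q)\<close> and \<open>(r, s)\<close> lie on the same side
  of the diagonal, one Euclidean step applies to all four vectors at once. Otherwise they form the
  standard basis and the relation is the recursion itself.\<close>

lemma euclid_markoff_edge:
  assumes "\<bar>int p * int s - int q * int r\<bar> = 1"
  shows "euclid_markoff p q A B C + euclid_markoff (p + 2 * r) (q + 2 * s) A B C =
    euclid_markoff r s A B C * euclid_markoff (p + r) (q + s) A B C"
  using assms
proof (induction "p + q + r + s" arbitrary: p q r s A B C rule: less_induct)
  case less
  have ne: "p \<noteq> 0 \<or> q \<noteq> 0" "r \<noteq> 0 \<or> s \<noteq> 0" "p \<noteq> 0 \<or> r \<noteq> 0" "q \<noteq> 0 \<or> s \<noteq> 0"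
    by (rule ccontr, use less.prems in simp)+
  consider "q \<le> p" "s \<le> r" | "p \<le> q" "r \<le> s" | "q < p" "r < s" | "p < q" "s < r" by linarith
  then show ?case
  proof cases
    case 1
    have "\<bar>int (p - q) * int s - int q * int (r - s)\<bar> = 1"
      using 1 less.prems by (simp add: of_nat_diff algebra_simps)
    then have "euclid_markoff (p - q) q A C (A * C - B) +
        euclid_markoff (p - q + 2 * (r - s)) (q + 2 * s) A C (A * C - B) =
        euclid_markoff (r - s) s A C (A * C - B) *
        euclid_markoff (p - q + (r - s)) (q + s) A C (A * C - B)"
      using 1 ne by (intro less.hyps) auto
    \<comment> \<open>Truncated subtraction commutes with these sums because no difference is cut
      off at 0.\<close>
    moreover have "p - q + 2 * (r - s) = p + 2 * r - (q + 2 * s)" "p - q + (r - s) = p + r - (q + s)"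
      using 1 by auto
    moreover have "p > 0" "r > 0" using 1 ne by auto
    ultimately show ?thesis
      using 1 by (simp add: euclid_markoff_step(1)[of _ p] euclid_markoff_step(1)[of _ r]
          euclid_markoff_step(1)[of _ "p + _"])
  next
    case 2
    have "\<bar>int p * int (s - r) - int (q - p) * int r\<bar> = 1"
      using 2 less.prems by (simp add: of_nat_diff algebra_simps)
    then have "euclid_markoff p (q - p) C B (B * C - A) +
        euclid_markoff (p + 2 * r) (q - p + 2 * (s - r)) C B (B * C - A) =
        euclid_markoff r (s - r) C B (B * C - A) *
        euclid_markoff (p + r) (q - p + (s - r)) C B (B * C - A)"
      using 2 ne by (intro less.hyps) auto
    moreover have "q - p + 2 * (s - r) = q + 2 * s - (p + 2 * r)" "q - p + (s - r) = q + s - (p + r)"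
      using 2 by auto
    moreover have "q > 0" "s > 0" using 2 ne by auto
    ultimately show ?thesis
      using 2 by (simp add: euclid_markoff_step(2)[of _ q] euclid_markoff_step(2)[of _ s]
          euclid_markoff_step(2)[of _ "q + _"])
  next
    case 3
    with unimodular_nonneg_diag[OF less.prems] have "p = 1" "q = 0" "r = 0" "s = 1" by auto
    then show ?thesis by (simp add: euclid_markoff_0 euclid_markoff_small)
  next
    case 4
    with unimodular_nonneg_diag[of "int q" "int r" "int p" "int s"] less.prems
    have "p = 0" "q = 1" "r = 1" "s = 0" by (auto simp: abs_minus_commute mult.commute)
    then show ?thesis by (simp add: euclid_markoff_0 euclid_markoff_small)
  qed
qed

text \<open>Vieta jumping: \<open>B\<close> and \<open>A * C - B\<close> are the two roots of the
  same quadratic equation, so the cubic expression is invariant along the recursion. The identity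
  \<open>vieta\<close> then keeps every new value above 2.\<close>

lemma euclid_markoff_gt_2:
  assumes "A > 2" "B > 2" "C > 2" "A\<^sup>2 + B\<^sup>2 + C\<^sup>2 - A * B * C < 4"
  shows "euclid_markoff p q A B C > 2"
  using assms
proof (induction p q A B C rule: euclid_markoff.induct)
  case (1 p q A B C)
  have vieta: "(A * C - B - 2) * (B - 2) = (A - C)\<^sup>2 + (4 - (A\<^sup>2 + B\<^sup>2 + C\<^sup>2 - A * B * C))"
    "(B * C - A - 2) * (A - 2) = (B - C)\<^sup>2 + (4 - (A\<^sup>2 + B\<^sup>2 + C\<^sup>2 - A * B * C))"
    by (simp_all add: algebra_simps power2_eq_square)
  have "(A * C - B - 2) * (B - 2) > 0" "(B * C - A - 2) * (A - 2) > 0"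
    unfolding vieta using "1.prems"(4) by (simp_all add: add_nonneg_pos)
  then have gt: "A * C - B > 2" "B * C - A > 2"
    using "1.prems"(1,2) by (simp_all add: zero_less_mult_iff)
  have "A\<^sup>2 + C\<^sup>2 + (A * C - B)\<^sup>2 - A * C * (A * C - B) = A\<^sup>2 + B\<^sup>2 + C\<^sup>2 - A * B * C"
    "C\<^sup>2 + B\<^sup>2 + (B * C - A)\<^sup>2 - C * B * (B * C - A) = A\<^sup>2 + B\<^sup>2 + C\<^sup>2 - A * B * C"
    by (simp_all add: algebra_simps power2_eq_square)
  with "1.IH" "1.prems" gt show ?case
    by (auto simp: euclid_markoff.simps[of p q])
qed

text \<open>For negative slopes the role of (1,1) is taken by (1,-1), whose value
  \<open>A * B - C\<close> is forced by the relation across the edge between \<open>Infty\<close>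
  and \<open>Fin 0\<close>.\<close>

definition signed_markoff :: "real \<Rightarrow> real \<Rightarrow> real \<Rightarrow> int \<Rightarrow> int \<Rightarrow> real" where
  "signed_markoff A B C p q =
     euclid_markoff (nat \<bar>p\<bar>) (nat \<bar>q\<bar>) A B (if p * q \<ge> 0 then C else A * B - C)"

lemma signed_markoff_uminus: "signed_markoff A B C (- p) (- q) = signed_markoff A B C p q"
  by (simp add: signed_markoff_def)

text \<open>The jump from \<open>C\<close> to \<open>A * B - C\<close> is an involution. On the axes
  \<open>euclid_markoff\<close> returns \<open>A\<close> or \<open>B\<close> for either third
  value.\<close>

lemma signed_markoff_mirror: "signed_markoff A B C (- p) q = signed_markoff A B (A * B - C) p q"
proof (cases "p * q = 0")
  case True
  then show ?thesis by (cases "p = 0") (auto simp: signed_markoff_def euclid_markoff_0)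
next
  case False
  then show ?thesis by (auto simp: signed_markoff_def)
qed

text \<open>Sign changes, exchange of the two vectors and reflection reduce the claim to nonnegative
  vectors with \<open>(r, s)\<close> below \<open>(p, q)\<close> in both coordinates. There
  \<open>euclid_markoff_edge\<close> applies, starting from their difference.\<close>

lemma signed_markoff_edge:
  assumes "\<bar>p * s - q * r\<bar> = 1"
  shows "signed_markoff A B C (p - r) (q - s) + signed_markoff A B C (p + r) (q + s) =
    signed_markoff A B C r s * signed_markoff A B C p q"
proof -
  define P where "P C p q r s \<longleftrightarrow>
    signed_markoff A B C (p - r) (q - s) + signed_markoff A B C (p + r) (q + s) =
    signed_markoff A B C r s * signed_markoff A B C p q" for C p q r s
  have flip: "P C (- p) (- q) r s \<longleftrightarrow> P C p q r s" for C p q r s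
    using signed_markoff_uminus[of A B C "p + r" "q + s"] signed_markoff_uminus[of A B C "p - r" "q - s"]
      signed_markoff_uminus[of A B C p q]
    by (simp add: P_def algebra_simps)
  have swap: "P C r s p q \<longleftrightarrow> P C p q r s" for C p q r s
    using signed_markoff_uminus[of A B C "p - r" "q - s"] by (simp add: P_def algebra_simps)
  have mirror: "P C (- p) q (- r) s \<longleftrightarrow> P (A * B - C) p q r s" for C p q r s
    using signed_markoff_mirror[of A B C "p - r"] signed_markoff_mirror[of A B C "p + r"]
    by (simp add: P_def signed_markoff_mirror algebra_simps)
  have sub: "P C p q r s" if u: "\<bar>p * s - q * r\<bar> = 1" and "0 \<le> r" "r \<le> p" "0 \<le> s" "s \<le> q" for C p q r s
  proof -
    have "\<bar>int (nat (p - r)) * int (nat s) - int (nat (q - s)) * int (nat r)\<bar> = 1"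
      using that by (simp add: algebra_simps)
    from euclid_markoff_edge[OF this, of A B C] that show ?thesis
      by (simp add: P_def signed_markoff_def nat_diff_distrib nat_add_distrib mult_2)
  qed
  have nonneg: "P C p q r s" if u: "\<bar>p * s - q * r\<bar> = 1" and n: "p \<ge> 0" "q \<ge> 0" "r \<ge> 0" "s \<ge> 0"
    for C p q r s
  proof -
    have u': "\<bar>r * q - s * p\<bar> = 1" using u by (simp add: abs_minus_commute mult.commute)
    have base: "P C 1 0 0 1"
      by (simp add: P_def signed_markoff_def euclid_markoff_0 euclid_markoff_small)
    \<comment> \<open>Incomparable vectors occur only as the standard basis, by
      \<open>unimodular_nonneg_sub\<close>.\<close>
    consider "r \<le> p" "s \<le> q" | "p \<le> r" "q \<le> s" | "r < p" "q < s" | "p < r" "s < q" by linarith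
    then show ?thesis
    proof cases
      case 1
      with sub u n show ?thesis by blast
    next
      case 2
      with sub[OF u'] n swap show ?thesis by blast
    next
      case 3
      with unimodular_nonneg_sub[OF u n] base show ?thesis by auto
    next
      case 4
      with unimodular_nonneg_sub[OF u'] n base show ?thesis by (auto simp: swap)
    qed
  qed
  have quadrant: "P C p q r s" if u: "\<bar>p * s - q * r\<bar> = 1" and "p * q \<ge> 0" "r * s \<ge> 0" for C p q r s
  proof -
    have u': "\<bar>(- p) * s - (- q) * r\<bar> = 1" "\<bar>p * (- s) - q * (- r)\<bar> = 1"
      "\<bar>(- p) * (- s) - (- q) * (- r)\<bar> = 1"
      using u by (simp_all add: abs_minus_commute)
    have flip': "P C p q (- r) (- s) \<longleftrightarrow> P C p q r s" for p q r s
      using swap[of C p q "- r" "- s"] flip[of C r s p q] swap[of C r s p q] by simp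
    have "p \<ge> 0 \<and> q \<ge> 0 \<or> p \<le> 0 \<and> q \<le> 0" "r \<ge> 0 \<and> s \<ge> 0 \<or> r \<le> 0 \<and> s \<le> 0"
      using that by (auto simp: zero_le_mult_iff)
    then show ?thesis
      using nonneg[OF u, of C] nonneg[OF u'(1), of C] nonneg[OF u'(2), of C] nonneg[OF u'(3), of C]
      by (elim disjE) (simp_all add: flip flip')
  qed
  \<comment> \<open>Vectors inside neighboring quadrants would give \<open>p * s\<close> and
    \<open>q * r\<close> opposite signs, hence a determinant of absolute value at least 2.\<close>
  have same_side: "p * q \<ge> 0 \<and> r * s \<ge> 0 \<or> p * q \<le> 0 \<and> r * s \<le> 0"
  proof (rule ccontr)
    assume "\<not> ?thesis"
    then have "(p * q) * (r * s) < 0"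
      by (auto simp: not_le intro: mult_pos_neg mult_neg_pos)
    then have "(p * s) * (q * r) < 0" by (simp add: mult_ac)
    then have "0 < p * s \<and> q * r < 0 \<or> p * s < 0 \<and> 0 < q * r"
      by (rule mult_less_0_iff[THEN iffD1])
    with assms show False by linarith
  qed
  have "P C p q r s"
  proof (cases "p * q \<ge> 0 \<and> r * s \<ge> 0")
    case True
    with quadrant assms show ?thesis by blast
  next
    case False
    with same_side have "P (A * B - C) (- p) q (- r) s"
      using assms by (intro quadrant) (auto simp: abs_minus_commute)
    then show ?thesis using mirror[of C "- p" q "- r" s] by simp
  qed
  then show ?thesis by (simp add: P_def)
qed

text \<open>Three coordinates above 2 suffice: by Vieta jumping all other values of the Markoff map
  they determine stay above 2.\<close>

lemma deformation_space_eq: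
  "deformation_space = {u. u $ 1 > 2 \<and> u $ 2 > 2 \<and> u $ 3 > 2 \<and>
     (u $ 1)\<^sup>2 + (u $ 2)\<^sup>2 + (u $ 3)\<^sup>2 - u $ 1 * u $ 2 * u $ 3 < 4}" (is "_ = ?X")
proof (intro equalityI subsetI)
  fix u assume "u \<in> deformation_space"
  then show "u \<in> ?X" by (auto simp: deformation_space_def geometric_def coords_def Let_def)
next
  fix u :: "real ^ 3"
  define A B C where "A = u $ 1" and "B = u $ 2" and "C = u $ 3"
  assume "u \<in> ?X"
  then have gt: "A > 2" "B > 2" "C > 2" and K: "A\<^sup>2 + B\<^sup>2 + C\<^sup>2 - A * B * C < 4"
    by (auto simp: A_def B_def C_def)
  have "A\<^sup>2 + B\<^sup>2 + (A * B - C)\<^sup>2 - A * B * (A * B - C) = A\<^sup>2 + B\<^sup>2 + C\<^sup>2 - A * B * C"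
    by (simp add: algebra_simps power2_eq_square)
  moreover have "A * B - C > 2"
  proof -
    have "(A * B - C - 2) * (C - 2) = (A - B)\<^sup>2 + (4 - (A\<^sup>2 + B\<^sup>2 + C\<^sup>2 - A * B * C))"
      by (simp add: algebra_simps power2_eq_square)
    also have "\<dots> > 0" using K by (simp add: add_nonneg_pos)
    finally show ?thesis using gt by (simp add: zero_less_mult_iff)
  qed
  ultimately have pos: "signed_markoff A B C p q > 2" for p q
    using gt K by (simp add: signed_markoff_def euclid_markoff_gt_2)
  define \<Phi> where "\<Phi> = (\<lambda>R. case reduced R of (p, q) \<Rightarrow> signed_markoff A B C p q)"
  have \<Phi>_region: "\<Phi> (region p q) = signed_markoff A B C p q" if "coprime p q" for p q
    using reduced_region[OF that] by (auto simp: \<Phi>_def signed_markoff_uminus)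
  have "markoff_map \<Phi>"
    unfolding markoff_map_def
  proof (intro allI impI)
    fix R R' R'' R'''
    assume "edge_config R R' R'' R'''"
    then obtain p q r s where u: "\<bar>p * s - q * r\<bar> = 1" and R: "R = region (p - r) (q - s)"
      "R' = region r s" "R'' = region p q" "R''' = region (p + r) (q + s)"
      by (rule edge_configE)
    have "coprime (p - r) (q - s)" "coprime (p + r) (q + s)"
      using u by (auto intro!: unimodular_coprime(1)[of _ s _ r] simp: algebra_simps)
    with unimodular_coprime[OF u] signed_markoff_edge[OF u] show "\<Phi> R + \<Phi> R''' = \<Phi> R' * \<Phi> R''"
      by (simp add: R \<Phi>_region)
  qed
  moreover have co: "\<Phi> Infty = A" "\<Phi> (Fin 0) = B" "\<Phi> (Fin 1) = C"
    by (simp_all add: \<Phi>_def signed_markoff_def euclid_markoff_0 euclid_markoff_small)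
  moreover have "\<Phi> R > 2" for R
    using pos by (simp add: \<Phi>_def split: prod.split)
  ultimately have "geometric \<Phi>"
    using K by (simp add: geometric_def)
  moreover have "coords \<Phi> = u"
    by (simp add: coords_def co vec_eq_iff forall_3 A_def B_def C_def)
  ultimately show "u \<in> deformation_space"
    unfolding deformation_space_def by blast
qed

section \<open>The discriminant cone\<close>

definition disc :: "real ^ 3 \<Rightarrow> real" where
  "disc v = 4 * v $ 1 * v $ 2 - (v $ 3 - v $ 1 - v $ 2)\<^sup>2"

text \<open>The diagonalization that exhibits the signature (1, 2). The sign of
  \<open>v $ 1 + v $ 2\<close> distinguishes the two nappes of the cone.\<close>

lemma disc_eq: "disc v = (v $ 1 + v $ 2)\<^sup>2 - (v $ 1 - v $ 2)\<^sup>2 - (v $ 3 - v $ 1 - v $ 2)\<^sup>2"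
  by (simp add: disc_def algebra_simps power2_eq_square)

lemma disc_scaleR: "disc (k *\<^sub>R v) = k\<^sup>2 * disc v"
  by (simp add: disc_def algebra_simps power2_eq_square)

lemma continuous_on_disc: "continuous_on S disc"
  unfolding disc_def by (intro continuous_intros)

text \<open>The form \<open>x\<^sup>2 + y\<^sup>2\<close>, the axis of the cone.\<close>

definition axis_form :: "real ^ 3" where
  "axis_form = vector [1, 1, 2]"

lemma disc_add_axis: "disc (v + k *\<^sub>R axis_form) = disc v + 4 * k * (v $ 1 + v $ 2) + 4 * k\<^sup>2"
  by (simp add: disc_def axis_form_def algebra_simps power2_eq_square)

text \<open>A nonzero null vector has nonzero \<open>s\<close>, so \<open>disc\<close> changes sign
  to first order when the vector is moved along the axis. This serves for both the closure and the
  interior of the polygon.\<close>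

lemma disc_zero_perturb:
  assumes "disc v = 0" "v \<noteq> 0" "open W" "v \<in> W"
  shows "\<exists>w\<in>W. disc w > 0" "\<exists>w\<in>W. disc w < 0"
proof -
  define s where "s = v $ 1 + v $ 2"
  have "s \<noteq> 0"
  proof
    assume "s = 0"
    have "(v $ 1 - v $ 2)\<^sup>2 + (v $ 3 - v $ 1 - v $ 2)\<^sup>2 = s\<^sup>2 - disc v"
      by (simp add: disc_eq s_def)
    also have "\<dots> = 0" using assms(1) \<open>s = 0\<close> by simp
    finally have "v $ 1 - v $ 2 = 0 \<and> v $ 3 - v $ 1 - v $ 2 = 0"
      by (simp only: sum_power2_eq_zero_iff)
    with \<open>s = 0\<close> have "v = 0" by (simp add: s_def vec_eq_iff forall_3)
    with assms(2) show False by simp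
  qed
  \<comment> \<open>The factor \<open>sgn s\<close> makes positive \<open>t\<close> point into the
    cone on either nappe.\<close>
  have "((\<lambda>t. v + (t * sgn s) *\<^sub>R axis_form) \<longlongrightarrow> v + (0 * sgn s) *\<^sub>R axis_form) (at 0)"
    by (intro tendsto_intros)
  then have "\<forall>\<^sub>F t in at 0. v + (t * sgn s) *\<^sub>R axis_form \<in> W"
    using assms(3,4) by (simp add: topological_tendstoD)
  then obtain d where "d > 0" and d: "\<And>t. t \<noteq> 0 \<Longrightarrow> \<bar>t\<bar> < d \<Longrightarrow> v + (t * sgn s) *\<^sub>R axis_form \<in> W"
    by (auto simp: eventually_at dist_real_def)
  have disc_t: "disc (v + (t * sgn s) *\<^sub>R axis_form) = 4 * t * (\<bar>s\<bar> + t)" for t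
    using assms(1) \<open>s \<noteq> 0\<close>
    by (simp add: disc_add_axis flip: s_def) (simp add: sgn_if power2_eq_square algebra_simps)
  \<comment> \<open>Staying below \<open>\<bar>s\<bar>\<close> keeps
    \<open>\<bar>s\<bar> - t\<close> positive for the step in the outward direction.\<close>
  define t where "t = min d \<bar>s\<bar> / 2"
  have t: "0 < t" "t < d" "t < \<bar>s\<bar>"
    using \<open>d > 0\<close> \<open>s \<noteq> 0\<close> by (auto simp: t_def min_def)
  have "disc (v + (t * sgn s) *\<^sub>R axis_form) > 0"
    unfolding disc_t by (rule mult_pos_pos) (use t in auto)
  moreover have "disc (v + (- t * sgn s) *\<^sub>R axis_form) < 0"
    unfolding disc_t by (rule mult_neg_pos) (use t in auto)
  ultimately show "\<exists>w\<in>W. disc w > 0" "\<exists>w\<in>W. disc w < 0"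
    using d[of t] d[of "- t"] t by (auto intro: bexI[rotated])
qed

section \<open>Definite forms and the increasing cone\<close>

lemma form_complete_square:
  "4 * v $ 1 * form v x y = (2 * v $ 1 * x + (v $ 3 - v $ 1 - v $ 2) * y)\<^sup>2 + disc v * y\<^sup>2"
  by (simp add: form_def disc_def algebra_simps power2_eq_square)

lemma form_pos:
  assumes "disc v > 0" "v $ 1 > 0" "x \<noteq> 0 \<or> y \<noteq> 0"
  shows "form v x y > 0"
proof (cases "y = 0")
  case False
  then have "4 * v $ 1 * form v x y > 0"
    unfolding form_complete_square using assms by (simp add: add_nonneg_pos)
  with assms show ?thesis by (simp add: zero_less_mult_iff)
qed (use assms in \<open>simp add: form_def\<close>)

lemma increasing_cone_superset:
  assumes "disc v > 0" "v $ 1 > 0"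
  shows "v \<in> increasing_cone (\<lambda>_. 2)"
proof -
  define F where "F = (\<lambda>R. case reduced R of (p, q) \<Rightarrow> form v (of_int p) (of_int q))"
  have "F R > 0" for R
  proof -
    obtain p q where pq: "reduced R = (p, q)" by fastforce
    from coprime_reduced[OF this] have "p \<noteq> 0 \<or> q \<noteq> 0" by auto
    with assms pq show ?thesis by (simp add: F_def form_pos)
  qed
  moreover have "coords F = v"
    by (simp add: coords_def F_def form_def vec_eq_iff forall_3)
  moreover have "infinitesimal_deformation (\<lambda>_. 2) F"
    using form_deformation by (simp add: F_def)
  ultimately show ?thesis
    unfolding increasing_cone_def mem_Collect_eq by (intro exI[of _ F]) simp
qed

text \<open>Positivity at all rational slopes extends by density and continuity to nonnegativity on
  the real line. A quadratic polynomial with positive leading coefficient is nonnegative only if its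
  discriminant is at most 0.\<close>

lemma increasing_cone_subset:
  assumes "v \<in> increasing_cone (\<lambda>_. 2)"
  shows "disc v \<ge> 0" "v \<noteq> 0"
proof -
  obtain \<Phi>' where \<Phi>': "infinitesimal_deformation (\<lambda>_. 2) \<Phi>'" "\<And>R. \<Phi>' R > 0" "v = coords \<Phi>'"
    using assms by (auto simp: increasing_cone_def)
  have pos: "form v (of_int p) (of_int q) > 0" if "coprime p q" for p q
    using deformation_eq_form[OF \<Phi>'(1) that] \<Phi>'(2,3) by metis
  from pos[of 1 0] have v1: "v $ 1 > 0" by (simp add: form_def)
  then show "v \<noteq> 0" by auto
  have rat: "form v x 1 \<ge> 0" if x: "x \<in> \<rat>" for x
  proof -
    obtain p q where pq: "q > 0" "coprime p q" "x = of_int p / of_int q"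
      using x by (elim Rats_cases') blast
    then have "real_of_int p = x * of_int q" by simp
    then have "form v (of_int p) (of_int q) = (of_int q)\<^sup>2 * form v x 1"
      by (simp add: form_def algebra_simps power2_eq_square)
    with pos[OF pq(2)] pq(1) show ?thesis by (simp add: zero_less_mult_iff)
  qed
  have "form v x 1 \<ge> 0" for x
  proof -
    have "continuous_on UNIV (\<lambda>x. form v x 1)"
      unfolding form_def by (intro continuous_intros)
    then have "closed {x. 0 \<le> form v x 1}"
      by (intro closed_Collect_le) auto
    with rat have "closure \<rat> \<subseteq> {x. 0 \<le> form v x 1}"
      by (intro closure_minimal) auto
    then show ?thesis by (auto simp: Rats_closure_real)
  qed
  \<comment> \<open>At the vertex of the parabola the completed square vanishes and only
    \<open>disc v\<close> remains.\<close>
  from this[of "- (v $ 3 - v $ 1 - v $ 2) / (2 * v $ 1)"] v1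
  have "0 \<le> 4 * v $ 1 * form v (- (v $ 3 - v $ 1 - v $ 2) / (2 * v $ 1)) 1" by simp
  also have "\<dots> = disc v"
    unfolding form_complete_square using v1 by simp
  finally show "disc v \<ge> 0" .
qed

section \<open>Cones and the projective plane\<close>

lemma proj_point_eq_iff:
  assumes "w \<noteq> 0"
  shows "proj_point v = proj_point w \<longleftrightarrow> (\<exists>k. k \<noteq> 0 \<and> v = k *\<^sub>R w)"
proof
  assume eq: "proj_point v = proj_point w"
  then obtain k where "v = k *\<^sub>R w"
    unfolding proj_point_def by (metis insertI1 span_base span_singleton imageE)
  moreover from eq obtain l where "w = l *\<^sub>R v"
    unfolding proj_point_def by (metis insertI1 span_base span_singleton imageE)
  ultimately show "\<exists>k. k \<noteq> 0 \<and> v = k *\<^sub>R w" using assms by fastforce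
next
  assume "\<exists>k. k \<noteq> 0 \<and> v = k *\<^sub>R w"
  then obtain k where k: "k \<noteq> 0" "v = k *\<^sub>R w" by blast
  have "l *\<^sub>R w = (l / k) *\<^sub>R v" for l using k by simp
  with k show "proj_point v = proj_point w"
    unfolding proj_point_def span_singleton by fastforce
qed

lemma projectivizeE:
  assumes "x \<in> projectivize S"
  obtains v where "x = proj_point v" "v \<noteq> 0" "v \<in> S"
  using assms by (auto simp: projectivize_def)

lemma projectivizeI: "v \<in> S \<Longrightarrow> v \<noteq> 0 \<Longrightarrow> proj_point v \<in> projectivize S"
  by (simp add: projectivize_def)

text \<open>For a set stable under all nonzero scalars, negative ones included, membership does not
  depend on the representative. Topological questions in the projective plane can then be decided in
  \<open>real ^ 3\<close>.\<close>

lemma proj_point_mem_projectivize: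
  assumes "\<And>w k. w \<in> S \<Longrightarrow> k \<noteq> 0 \<Longrightarrow> k *\<^sub>R w \<in> S" "v \<noteq> 0"
  shows "proj_point v \<in> projectivize S \<longleftrightarrow> v \<in> S"
proof
  assume "proj_point v \<in> projectivize S"
  then obtain w where w: "proj_point v = proj_point w" "w \<noteq> 0" "w \<in> S" by (rule projectivizeE)
  then obtain k where "k \<noteq> 0" "v = k *\<^sub>R w" using proj_point_eq_iff by blast
  with assms(1) w(3) show "v \<in> S" by blast
qed (use assms(2) in \<open>simp add: projectivizeI\<close>)

lemma openin_projectivize:
  assumes "open S" "\<And>w k. w \<in> S \<Longrightarrow> k \<noteq> 0 \<Longrightarrow> k *\<^sub>R w \<in> S"
  shows "openin projective_plane (projectivize S)"
proof -
  have "{v. v \<noteq> 0 \<and> proj_point v \<in> projectivize S} = S - {0}"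
    using proj_point_mem_projectivize[OF assms(2)] by blast
  moreover have "projectivize S \<subseteq> projectivize UNIV"
    unfolding projectivize_def by blast
  ultimately show ?thesis
    using assms(1) by (simp add: openin_projective_plane open_delete)
qed

lemma closedin_projectivize:
  assumes "closed S" "\<And>w k. w \<in> S \<Longrightarrow> k \<noteq> 0 \<Longrightarrow> k *\<^sub>R w \<in> S"
  shows "closedin projective_plane (projectivize S)"
proof -
  have "{v. v \<noteq> 0 \<and> proj_point v \<in> projectivize UNIV - projectivize S} = - S - {0}"
    using proj_point_mem_projectivize[OF assms(2)] by (auto simp: projectivizeI)
  moreover have "projectivize S \<subseteq> projectivize UNIV"
    unfolding projectivize_def by blast
  ultimately show ?thesis
    using assms(1)
    by (simp add: closedin_def topspace_projective_plane openin_projective_plane open_delete open_Compl)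
qed

lemma proj_point_mem_disc:
  assumes "v \<noteq> 0"
  shows "proj_point v \<in> projectivize {v. disc v > 0} \<longleftrightarrow> disc v > 0"
    and "proj_point v \<in> projectivize {v. disc v \<ge> 0} \<longleftrightarrow> disc v \<ge> 0"
  using proj_point_mem_projectivize[OF _ assms, of "{v. disc v > 0}"]
    proj_point_mem_projectivize[OF _ assms, of "{v. disc v \<ge> 0}"]
  by (simp_all add: disc_scaleR)

lemma openin_disc_pos: "openin projective_plane (projectivize {v. disc v > 0})"
  using open_Collect_less[OF continuous_on_const continuous_on_disc]
  by (rule openin_projectivize) (simp add: disc_scaleR)

lemma closedin_disc_nonneg: "closedin projective_plane (projectivize {v. disc v \<ge> 0})"
  using closed_Collect_le[OF continuous_on_const continuous_on_disc]
  by (rule closedin_projectivize) (simp add: disc_scaleR)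

section \<open>Closure, interior and frontier of the polygon\<close>

lemma polygon_superset: "projectivize {v. disc v > 0} \<subseteq> polygon (\<lambda>_. 2)"
proof
  fix x assume "x \<in> projectivize {v. disc v > 0}"
  then obtain v where v: "x = proj_point v" "v \<noteq> 0" "disc v > 0" by (auto elim: projectivizeE)
  \<comment> \<open>A negative definite form represents the same projective point as its negative,
    which is positive definite.\<close>
  define k where "k = sgn (v $ 1)"
  have "v $ 1 \<noteq> 0"
  proof
    assume "v $ 1 = 0"
    with v(3) show False by (simp add: disc_def)
  qed
  then have "k \<noteq> 0" "k * v $ 1 > 0" by (auto simp: k_def sgn_if)
  with v have "k *\<^sub>R v \<in> increasing_cone (\<lambda>_. 2)" "k *\<^sub>R v \<noteq> 0"
    by (simp_all add: increasing_cone_superset disc_scaleR)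
  moreover have "x = proj_point (k *\<^sub>R v)"
    using proj_point_eq_iff[OF v(2), of "k *\<^sub>R v"] \<open>k \<noteq> 0\<close> v(1) by metis
  ultimately show "x \<in> polygon (\<lambda>_. 2)"
    by (simp add: polygon_def projectivizeI)
qed

lemma polygon_subset: "polygon (\<lambda>_. 2) \<subseteq> projectivize {v. disc v \<ge> 0}"
  using increasing_cone_subset unfolding polygon_def projectivize_def by blast

text \<open>The closed disk contains the polygon, and each point of the conic is approached through
  \<open>disc > 0\<close> by \<open>disc_zero_perturb\<close>.\<close>

lemma closure_of_polygon:
  "projective_plane closure_of polygon (\<lambda>_. 2) = projectivize {v. disc v \<ge> 0}"
proof
  show "projective_plane closure_of polygon (\<lambda>_. 2) \<subseteq> projectivize {v. disc v \<ge> 0}"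
    by (intro closure_of_minimal polygon_subset closedin_disc_nonneg)
  show "projectivize {v. disc v \<ge> 0} \<subseteq> projective_plane closure_of polygon (\<lambda>_. 2)"
  proof
    fix x assume "x \<in> projectivize {v. disc v \<ge> 0}"
    then obtain v where v: "x = proj_point v" "v \<noteq> 0" "disc v \<ge> 0" by (auto elim: projectivizeE)
    have "\<exists>y. y \<in> polygon (\<lambda>_. 2) \<and> y \<in> T" if T: "x \<in> T" "openin projective_plane T" for T
    proof -
      define W where "W = {v. v \<noteq> 0 \<and> proj_point v \<in> T}"
      have W: "open W" "v \<in> W" using T v by (simp_all add: W_def openin_projective_plane)
      obtain w where w: "w \<in> W" "disc w > 0"
        using disc_zero_perturb(1)[OF _ v(2) W] v(3) W(2) by (cases "disc v = 0") auto
      then have "proj_point w \<in> projectivize {v. disc v > 0}" "proj_point w \<in> T"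
        by (simp_all add: W_def projectivizeI)
      with polygon_superset show ?thesis by blast
    qed
    moreover have "x \<in> topspace projective_plane"
      using v by (simp add: topspace_projective_plane projectivizeI)
    ultimately show "x \<in> projective_plane closure_of polygon (\<lambda>_. 2)"
      unfolding in_closure_of by blast
  qed
qed

lemma interior_of_polygon:
  "projective_plane interior_of polygon (\<lambda>_. 2) = projectivize {v. disc v > 0}"
proof
  show "projectivize {v. disc v > 0} \<subseteq> projective_plane interior_of polygon (\<lambda>_. 2)"
    by (intro interior_of_maximal polygon_superset openin_disc_pos)
  show "projective_plane interior_of polygon (\<lambda>_. 2) \<subseteq> projectivize {v. disc v > 0}"
  proof
    fix x assume "x \<in> projective_plane interior_of polygon (\<lambda>_. 2)"
    then obtain T where T: "openin projective_plane T" "x \<in> T" "T \<subseteq> polygon (\<lambda>_. 2)"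
      unfolding interior_of_def by blast
    define W where "W = {v. v \<noteq> 0 \<and> proj_point v \<in> T}"
    have nonneg: "disc w \<ge> 0" if "w \<in> W" for w
      using T(3) polygon_subset that proj_point_mem_disc(2)[of w] by (auto simp: W_def)
    obtain v where v: "x = proj_point v" "v \<noteq> 0"
      using T(1,2) by (auto simp: openin_projective_plane elim: projectivizeE)
    have W: "open W" "v \<in> W" using T v by (simp_all add: W_def openin_projective_plane)
    \<comment> \<open>Near a point of the conic there are vectors with negative \<open>disc\<close>,
      which lie outside the polygon.\<close>
    have "disc v \<noteq> 0"
      using disc_zero_perturb(2)[OF _ v(2) W] nonneg by (meson not_le)
    with nonneg[OF W(2)] v show "x \<in> projectivize {v. disc v > 0}" by (simp add: projectivizeI)
  qed
qed

lemma frontier_of_polygon: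
  "projective_plane frontier_of polygon (\<lambda>_. 2) = projectivize {v. disc v = 0}"
  unfolding frontier_of_def closure_of_polygon interior_of_polygon
proof (intro equalityI subsetI)
  fix x assume x: "x \<in> projectivize {v. disc v \<ge> 0} - projectivize {v. disc v > 0}"
  then obtain v where "x = proj_point v" "v \<noteq> 0" "disc v \<ge> 0" by (auto elim: projectivizeE)
  with x proj_point_mem_disc[of v] show "x \<in> projectivize {v. disc v = 0}"
    by (simp add: projectivizeI)
next
  fix x assume "x \<in> projectivize {v. disc v = 0}"
  then obtain v where "x = proj_point v" "v \<noteq> 0" "disc v = 0" by (auto elim: projectivizeE)
  with proj_point_mem_disc[of v]
  show "x \<in> projectivize {v. disc v \<ge> 0} - projectivize {v. disc v > 0}"
    by simp
qed

lemma nondegenerate_conic_disc: "nondegenerate_conic (projectivize {v. disc v = 0})"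
proof -
  \<comment> \<open>The Gram matrix of \<open>disc\<close>, read off from its expansion as minus the
    squares plus twice the mixed products.\<close>
  define M :: "real ^ 3 ^ 3" where
    "M = vector [vector [- 1, 1, 1], vector [1, - 1, 1], vector [1, 1, - 1]]"
  have "transpose M = M" by (simp add: M_def transpose_def vec_eq_iff forall_3)
  moreover have "det M \<noteq> 0" by (simp add: M_def det_3)
  moreover have "v \<bullet> (M *v v) = disc v" for v
    by (simp add: M_def inner_vec_def matrix_vector_mult_def sum_3 disc_def algebra_simps power2_eq_square)
  ultimately show ?thesis
    unfolding nondegenerate_conic_def by (intro exI[of _ M]) simp
qed

text \<open>The affine chart \<open>v\<^sub>1 + v\<^sub>2 = 1\<close>, in which the conic is the unit circle.\<close>

definition chart_inv :: "real ^ 2 \<Rightarrow> real ^ 3" where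
  "chart_inv y = vector [(1 + y $ 1) / 2, (1 - y $ 1) / 2, 1 + y $ 2]"

definition chart :: "real ^ 3 \<Rightarrow> real ^ 2" where
  "chart v = vector [(v $ 1 - v $ 2) / (v $ 1 + v $ 2), (v $ 3 - v $ 1 - v $ 2) / (v $ 1 + v $ 2)]"

lemma chart_inv_nth [simp]:
  "chart_inv y $ 1 = (1 + y $ 1) / 2" "chart_inv y $ 2 = (1 - y $ 1) / 2" "chart_inv y $ 3 = 1 + y $ 2"
  by (simp_all add: chart_inv_def)

lemma chart_inv_sum: "chart_inv y $ 1 + chart_inv y $ 2 = 1"
  by (simp add: field_simps)

lemma chart_inv_nonzero: "chart_inv y \<noteq> 0"
  using chart_inv_sum[of y] by (metis add.right_neutral zero_index zero_neq_one)

lemma chart_chart_inv: "chart (chart_inv y) = y"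
  by (simp add: chart_def chart_inv_sum vec_eq_iff forall_2) (simp add: field_simps)

lemma chart_scaleR:
  assumes "k \<noteq> 0"
  shows "chart (k *\<^sub>R v) = chart v"
proof -
  have "(k *\<^sub>R v) $ 1 + (k *\<^sub>R v) $ 2 = k * (v $ 1 + v $ 2)"
    "(k *\<^sub>R v) $ 1 - (k *\<^sub>R v) $ 2 = k * (v $ 1 - v $ 2)"
    "(k *\<^sub>R v) $ 3 - (k *\<^sub>R v) $ 1 - (k *\<^sub>R v) $ 2 = k * (v $ 3 - v $ 1 - v $ 2)"
    by (simp_all add: algebra_simps)
  with assms show ?thesis unfolding chart_def by simp
qed

lemma chart_inv_chart:
  assumes "v $ 1 + v $ 2 \<noteq> 0"
  shows "v = (v $ 1 + v $ 2) *\<^sub>R chart_inv (chart v)"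
proof -
  define s d e where "s = v $ 1 + v $ 2" and "d = v $ 1 - v $ 2" and "e = v $ 3 - v $ 1 - v $ 2"
  have "s \<noteq> 0" using assms by (simp add: s_def)
  moreover have "chart v $ 1 = d / s" "chart v $ 2 = e / s"
    by (simp_all add: chart_def s_def d_def e_def)
  ultimately have "(s *\<^sub>R chart_inv (chart v)) $ 1 = (s + d) / 2"
    "(s *\<^sub>R chart_inv (chart v)) $ 2 = (s - d) / 2"
    "(s *\<^sub>R chart_inv (chart v)) $ 3 = s + e"
    by (simp_all add: field_simps)
  moreover have "(s + d) / 2 = v $ 1" "(s - d) / 2 = v $ 2" "s + e = v $ 3"
    by (simp_all add: s_def d_def e_def)
  ultimately have "v = s *\<^sub>R chart_inv (chart v)"
    unfolding vec_eq_iff forall_3 by (simp only: simp_thms)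
  then show ?thesis by (simp add: s_def)
qed

lemma disc_chart_inv: "disc (chart_inv y) = 1 - (norm y)\<^sup>2"
proof -
  have "disc (chart_inv y) = 1 - (y $ 1)\<^sup>2 - (y $ 2)\<^sup>2"
    by (simp add: disc_def field_simps power2_eq_square)
  moreover have "(norm y)\<^sup>2 = (y $ 1)\<^sup>2 + (y $ 2)\<^sup>2"
    unfolding power2_norm_eq_inner by (simp add: inner_vec_def sum_2 power2_eq_square)
  ultimately show ?thesis by simp
qed

lemma disc_chart_inv_pos: "disc (chart_inv y) > 0 \<longleftrightarrow> y \<in> ball 0 1"
  by (simp add: disc_chart_inv abs_square_less_1)

text \<open>Hence the chart is defined on the whole open disk.\<close>

lemma disc_pos_sum_nonzero: "disc v > 0 \<Longrightarrow> v $ 1 + v $ 2 \<noteq> 0"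
proof
  assume "disc v > 0" "v $ 1 + v $ 2 = 0"
  moreover have "disc v \<le> (v $ 1 + v $ 2)\<^sup>2" by (simp add: disc_eq)
  ultimately show False by simp
qed

lemma proj_point_chart_inv:
  assumes "v $ 1 + v $ 2 \<noteq> 0"
  shows "proj_point v = proj_point (chart_inv (chart v))"
  using chart_inv_chart[OF assms] assms
  by (intro iffD2[OF proj_point_eq_iff] chart_inv_nonzero exI[of _ "v $ 1 + v $ 2"] conjI)

text \<open>Writes the image as the projectivization of a cone, so that its openness can be checked
  upstairs with \<open>openin_projectivize\<close>.\<close>

lemma proj_point_chart_inv_image:
  "(proj_point \<circ> chart_inv) ` W = projectivize {v. v $ 1 + v $ 2 \<noteq> 0 \<and> chart v \<in> W}"
proof (intro equalityI subsetI)
  fix x assume "x \<in> (proj_point \<circ> chart_inv) ` W"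
  then obtain y where y: "y \<in> W" "x = proj_point (chart_inv y)" by auto
  have "chart_inv y \<in> {v. v $ 1 + v $ 2 \<noteq> 0 \<and> chart v \<in> W}"
    using y(1) by (simp add: chart_chart_inv chart_inv_sum del: chart_inv_nth)
  then show "x \<in> projectivize {v. v $ 1 + v $ 2 \<noteq> 0 \<and> chart v \<in> W}"
    unfolding y(2) by (rule projectivizeI) (rule chart_inv_nonzero)
next
  fix x assume "x \<in> projectivize {v. v $ 1 + v $ 2 \<noteq> 0 \<and> chart v \<in> W}"
  then obtain v where v: "x = proj_point v" "v $ 1 + v $ 2 \<noteq> 0" "chart v \<in> W"
    by (auto elim: projectivizeE)
  then have "x = (proj_point \<circ> chart_inv) (chart v)"
    using proj_point_chart_inv[OF v(2)] by (metis o_apply)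
  then show "x \<in> (proj_point \<circ> chart_inv) ` W"
    using v(3) by (rule image_eqI)
qed

lemma openin_proj_point_chart_inv_image:
  assumes "open W"
  shows "openin projective_plane ((proj_point \<circ> chart_inv) ` W)"
proof -
  let ?U = "{v :: real ^ 3. v $ 1 + v $ 2 \<noteq> 0}"
  have "?U = - {v. v $ 1 + v $ 2 = 0}" by auto
  moreover have "closed {v :: real ^ 3. v $ 1 + v $ 2 = 0}"
    by (intro closed_Collect_eq continuous_intros)
  ultimately have "open ?U" by (simp add: open_Compl)
  moreover have "continuous_on ?U chart"
  proof -
    have "continuous_on ?U (\<lambda>v. \<chi> i. chart v $ i)"
    proof (rule continuous_on_vec_lambda)
      show "continuous_on ?U (\<lambda>v. chart v $ i)" for i
        using exhaust_2[of i] by (elim disjE) (simp_all add: chart_def, (force intro!: continuous_intros)+)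
    qed
    then show ?thesis by simp
  qed
  ultimately have "open (?U \<inter> chart -` W)"
    using assms by (simp add: continuous_open_preimage)
  moreover have "?U \<inter> chart -` W = {v. v $ 1 + v $ 2 \<noteq> 0 \<and> chart v \<in> W}" by auto
  ultimately show ?thesis
    unfolding proj_point_chart_inv_image
  proof (intro openin_projectivize)
    fix w :: "real ^ 3" and k :: real
    assume "w \<in> {v. v $ 1 + v $ 2 \<noteq> 0 \<and> chart v \<in> W}" "k \<noteq> 0"
    moreover from this have "k * (w $ 1 + w $ 2) \<noteq> 0" by simp
    ultimately show "k *\<^sub>R w \<in> {v. v $ 1 + v $ 2 \<noteq> 0 \<and> chart v \<in> W}"
      by (simp add: chart_scaleR distrib_left)
  qed simp
qed

text \<open>The inverse chart followed by the projection maps the unit ball continuously, openly and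
  bijectively onto the open disk.\<close>

lemma interior_homeomorphic_ball:
  "subtopology projective_plane (projectivize {v. disc v > 0})
     homeomorphic_space top_of_set (ball (0 :: real ^ 2) 1)"
proof -
  let ?P = "projectivize {v. disc v > 0}" and ?g = "proj_point \<circ> chart_inv"
  have "disc v > 0 \<longleftrightarrow> v $ 1 + v $ 2 \<noteq> 0 \<and> chart v \<in> ball 0 1" for v
  proof (cases "v $ 1 + v $ 2 = 0")
    case False
    have "disc v = (v $ 1 + v $ 2)\<^sup>2 * disc (chart_inv (chart v))"
      by (subst chart_inv_chart[OF False]) (rule disc_scaleR)
    with False have "disc v > 0 \<longleftrightarrow> disc (chart_inv (chart v)) > 0"
      by (simp add: zero_less_mult_iff)
    with False show ?thesis unfolding disc_chart_inv_pos by blast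
  qed (use disc_pos_sum_nonzero in blast)
  then have image: "?g ` ball 0 1 = ?P"
    unfolding proj_point_chart_inv_image by simp
  have "continuous_on UNIV chart_inv"
  proof -
    have "continuous_on UNIV (\<lambda>y. \<chi> i. chart_inv y $ i)"
    proof (rule continuous_on_vec_lambda)
      show "continuous_on UNIV (\<lambda>y. chart_inv y $ i)" for i
        using exhaust_3[of i] by (elim disjE) (simp_all, (intro continuous_intros; simp)+)
    qed
    then show ?thesis by simp
  qed
  then have "continuous_map (top_of_set (ball 0 1)) (top_of_set (- {0})) chart_inv"
    by (auto simp: chart_inv_nonzero intro: continuous_on_subset)
  then have "continuous_map (top_of_set (ball 0 1)) projective_plane ?g"
    using quotient_imp_continuous_map[OF quotient_map_proj_point] by (rule continuous_map_compose)
  then have cont: "continuous_map (top_of_set (ball 0 1)) (subtopology projective_plane ?P) ?g"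
    using image by (auto simp: continuous_map_in_subtopology)
  have "open_map (top_of_set (ball 0 1)) (subtopology projective_plane ?P) ?g"
    unfolding open_map_def
  proof (intro allI impI)
    fix W :: "(real ^ 2) set" assume "openin (top_of_set (ball 0 1)) W"
    then have "open W" "W \<subseteq> ball 0 1" by (auto simp: openin_open_eq)
    then show "openin (subtopology projective_plane ?P) (?g ` W)"
      using openin_proj_point_chart_inv_image image
      by (metis openin_open_subtopology openin_disc_pos image_mono)
  qed
  \<comment> \<open>The chart is constant on lines through the origin, so it recovers the point of
    the ball.\<close>
  moreover have "inj ?g"
  proof (rule injI)
    fix y z assume "?g y = ?g z"
    then obtain k where "k \<noteq> 0" "chart_inv y = k *\<^sub>R chart_inv z"
      using proj_point_eq_iff[OF chart_inv_nonzero] by auto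
    then show "y = z" by (metis chart_chart_inv chart_scaleR)
  qed
  moreover have "?P \<subseteq> topspace projective_plane"
    using openin_disc_pos by (rule openin_subset)
  ultimately have "homeomorphic_map (top_of_set (ball 0 1)) (subtopology projective_plane ?P) ?g"
    using cont image
    by (intro bijective_open_imp_homeomorphic_map) (auto intro: inj_on_subset)
  then show ?thesis
    by (meson homeomorphic_map_imp_homeomorphic_space homeomorphic_space_sym)
qed

section \<open>The tangent cone of the deformation space\<close>

text \<open>Expanding \<open>K < 2\<close> around (2, 2, 2) cancels the constant and linear terms.
  On the closure the inequality becomes weak.\<close>

lemma disc_deformation_space:
  assumes "u \<in> closure deformation_space"
  defines "h \<equiv> u - vector [2, 2, 2]"
  shows "disc h + h $ 1 * h $ 2 * h $ 3 \<ge> 0"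
proof -
  have "closed {u :: real ^ 3. (u $ 1)\<^sup>2 + (u $ 2)\<^sup>2 + (u $ 3)\<^sup>2 - u $ 1 * u $ 2 * u $ 3 \<le> 4}"
    by (intro closed_Collect_le continuous_intros)
  then have "closure deformation_space \<subseteq> {u. (u $ 1)\<^sup>2 + (u $ 2)\<^sup>2 + (u $ 3)\<^sup>2 - u $ 1 * u $ 2 * u $ 3 \<le> 4}"
    by (intro closure_minimal) (auto simp: deformation_space_eq)
  with assms(1) have "(u $ 1)\<^sup>2 + (u $ 2)\<^sup>2 + (u $ 3)\<^sup>2 - u $ 1 * u $ 2 * u $ 3 \<le> 4" by blast
  then show ?thesis
    by (simp add: h_def disc_def algebra_simps power2_eq_square)
qed

text \<open>The coordinates of \<open>h\<close> are values of a positive definite form, hence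
  positive. The cubic term therefore has the favorable sign, and the translated open nappe lies in
  the space with no smallness condition on \<open>h\<close>.\<close>

lemma deformation_space_translate:
  assumes "disc h > 0" "h $ 1 + h $ 2 > 0"
  shows "vector [2, 2, 2] + h \<in> deformation_space"
proof -
  have "h $ 1 * h $ 2 > 0"
    using assms(1) zero_le_power2[of "h $ 3 - h $ 1 - h $ 2"] unfolding disc_def by linarith
  with assms(2) have pos: "h $ 1 > 0" "h $ 2 > 0" by (auto simp: zero_less_mult_iff)
  have "form h 1 1 > 0" using assms(1) pos(1) by (intro form_pos) auto
  then have "h $ 3 > 0" by (simp add: form_def)
  with pos assms(1) have "disc h + h $ 1 * h $ 2 * h $ 3 > 0" by (simp add: add_pos_pos)
  then show ?thesis
    using pos \<open>h $ 3 > 0\<close>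
    by (simp add: deformation_space_eq disc_def algebra_simps power2_eq_square)
qed

text \<open>Adding a small positive multiple of the axis pushes boundary vectors into the open
  cone.\<close>

lemma closure_deformation_space_translate:
  assumes "disc h \<ge> 0" "h $ 1 + h $ 2 \<ge> 0"
  shows "vector [2, 2, 2] + h \<in> closure deformation_space"
proof -
  have "vector [2, 2, 2] + (h + (1 / Suc n) *\<^sub>R axis_form) \<in> deformation_space" for n
  proof (rule deformation_space_translate)
    show "disc (h + (1 / Suc n) *\<^sub>R axis_form) > 0"
      unfolding disc_add_axis using assms by (intro add_nonneg_pos add_nonneg_nonneg) auto
    have "(h + (1 / Suc n) *\<^sub>R axis_form) $ 1 + (h + (1 / Suc n) *\<^sub>R axis_form) $ 2 =
        h $ 1 + h $ 2 + 2 / Suc n"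
      by (simp add: axis_form_def)
    also have "\<dots> > 0" using assms(2) by (intro add_nonneg_pos) auto
    finally show "(h + (1 / Suc n) *\<^sub>R axis_form) $ 1 + (h + (1 / Suc n) *\<^sub>R axis_form) $ 2 > 0" .
  qed
  moreover have "(\<lambda>n. vector [2, 2, 2] + (h + (1 / Suc n) *\<^sub>R axis_form)) \<longlonglongrightarrow>
      vector [2, 2, 2] + (h + 0 *\<^sub>R axis_form)"
    by (intro tendsto_intros LIMSEQ_inverse_real_of_nat[unfolded inverse_eq_divide])
  ultimately show ?thesis
    unfolding closure_sequential by (intro exI conjI allI) simp_all
qed

lemma disc_nonneg_of_tangent_cone:
  assumes "v \<in> tangent_cone (closure deformation_space) (vector [2, 2, 2])"
  shows "disc v \<ge> 0"
proof -
  obtain x t where x: "\<And>n. x n \<in> closure deformation_space" "\<And>n. t n > 0" "x \<longlonglongrightarrow> vector [2, 2, 2]"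
    and lim: "(\<lambda>n :: nat. t n *\<^sub>R (x n - vector [2, 2, 2])) \<longlonglongrightarrow> v"
    using assms unfolding tangent_cone_def by blast
  define h where "h = (\<lambda>n. x n - vector [2, 2, 2])"
  have h: "h \<longlonglongrightarrow> 0" using x(3) by (simp add: h_def LIM_zero)
  define w where "w = (\<lambda>n. t n *\<^sub>R h n)"
  have w: "w \<longlonglongrightarrow> v" using lim by (simp add: w_def h_def)
  \<comment> \<open>Scaling by the square of \<open>t n\<close> turns the quadratic part into
    \<open>disc (w n)\<close> but absorbs only two factors of the cubic term. The third factor,
    \<open>h n $ 3\<close>, tends to 0, so the cubic term vanishes in the limit.\<close>
  have "0 \<le> disc (w n) + w n $ 1 * w n $ 2 * h n $ 3" for n
  proof -
    have "0 \<le> (t n)\<^sup>2 * (disc (h n) + h n $ 1 * h n $ 2 * h n $ 3)"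
      using disc_deformation_space[OF x(1)] by (simp add: h_def)
    also have "\<dots> = disc (w n) + w n $ 1 * w n $ 2 * h n $ 3"
      by (simp add: w_def disc_scaleR algebra_simps power2_eq_square)
    finally show ?thesis .
  qed
  moreover have "(\<lambda>n. disc (w n) + w n $ 1 * w n $ 2 * h n $ 3) \<longlonglongrightarrow> disc v + v $ 1 * v $ 2 * (0 :: real ^ 3) $ 3"
    unfolding disc_def by (intro tendsto_intros w h)
  ultimately have "0 \<le> disc v + v $ 1 * v $ 2 * (0 :: real ^ 3) $ 3"
    by (intro LIMSEQ_le_const) auto
  then show ?thesis by simp
qed

text \<open>The translated closed nappe is a cone with apex (2, 2, 2), so the points at
  \<open>v / (n + 1)\<close> from the apex stay in the closure and their rescaled secants equal
  \<open>v\<close>.\<close>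

lemma tangent_cone_of_disc_nonneg:
  assumes "disc v \<ge> 0" "v $ 1 + v $ 2 \<ge> 0"
  shows "v \<in> tangent_cone (closure deformation_space) (vector [2, 2, 2])"
proof -
  have "(\<lambda>n. vector [2, 2, 2] + (1 / Suc n) *\<^sub>R v) \<longlonglongrightarrow> vector [2, 2, 2] + 0 *\<^sub>R v"
    by (intro tendsto_intros LIMSEQ_inverse_real_of_nat[unfolded inverse_eq_divide])
  moreover have "vector [2, 2, 2] + (1 / Suc n) *\<^sub>R v \<in> closure deformation_space" for n
    using assms by (intro closure_deformation_space_translate) (auto simp: disc_scaleR simp flip: add_divide_distrib)
  moreover have "(\<lambda>n. real (Suc n) *\<^sub>R (vector [2, 2, 2] + (1 / Suc n) *\<^sub>R v - vector [2, 2, 2])) \<longlonglongrightarrow> v"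
    by simp
  ultimately show ?thesis
    unfolding tangent_cone_def mem_Collect_eq
    by (intro exI[of _ "\<lambda>n. vector [2, 2, 2] + (1 / Suc n) *\<^sub>R v"] exI[of _ "\<lambda>n. real (Suc n)"]) simp
qed

lemma projectivize_tangent_cone:
  "projectivize (tangent_cone (closure deformation_space) (vector [2, 2, 2])) =
     projectivize {v. disc v \<ge> 0}"
proof (intro equalityI subsetI)
  fix x assume "x \<in> projectivize (tangent_cone (closure deformation_space) (vector [2, 2, 2]))"
  then obtain v where "x = proj_point v" "v \<noteq> 0" "disc v \<ge> 0"
    by (blast elim: projectivizeE dest: disc_nonneg_of_tangent_cone)
  then show "x \<in> projectivize {v. disc v \<ge> 0}" by (simp add: projectivizeI)
next
  fix x assume "x \<in> projectivize {v. disc v \<ge> 0}"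
  then obtain v where v: "x = proj_point v" "v \<noteq> 0" "disc v \<ge> 0" by (auto elim: projectivizeE)
  show "x \<in> projectivize (tangent_cone (closure deformation_space) (vector [2, 2, 2]))"
  proof (cases "v $ 1 + v $ 2 \<ge> 0")
    case True
    with v show ?thesis by (simp add: projectivizeI tangent_cone_of_disc_nonneg)
  next
    case False
    \<comment> \<open>The other nappe gives the same projective points after a change of
      sign.\<close>
    with v(3) have "- v \<in> tangent_cone (closure deformation_space) (vector [2, 2, 2])"
      using disc_scaleR[of "- 1" v] by (intro tangent_cone_of_disc_nonneg) auto
    moreover have "x = proj_point (- v)"
      using proj_point_eq_iff[OF v(2), of "- v"] v(1) by (metis scaleR_minus1_left neg_equal_0_iff_equal zero_neq_one)
    ultimately show ?thesis using v(2) by (simp add: projectivizeI)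
  qed
qed

text \<open>The tangent cone yields the closed disk, whereas the polygon omits those points of its
  conic that are squares of rational linear forms. The comparison is therefore made with the closure
  of the polygon.\<close>

theorem theorem7p1:
  shows "round_projective_disk (polygon (\<lambda>_. 2)) \<and>
         projectivize (tangent_cone (closure deformation_space) (vector [2, 2, 2])) =
           projective_plane closure_of (polygon (\<lambda>_. 2))"
proof -
  have "polygon (\<lambda>_. 2) \<subseteq> topspace projective_plane"
    unfolding polygon_def topspace_projective_plane projectivize_def by blast
  then have "round_projective_disk (polygon (\<lambda>_. 2))"
    by (simp add: round_projective_disk_def frontier_of_polygon nondegenerate_conic_disc
        interior_of_polygon interior_homeomorphic_ball)
  then show ?thesis
    by (simp add: projectivize_tangent_cone closure_of_polygon)
qed

end
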